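(* Let $d$ be either $0$ or a positive square-free integer, $K=\mathbb{Q}(\sqrt{-d})$, $R$ the ring of integers of $K$, and $n\geq1$. (a) For any such $d$, $\alpha(\Gamma_{1,n})=2n$. (b) If $d\neq1,3$, $\alpha(\Gamma^{un}_{2,n})=2n$. (c) If $d=1$, $\alpha(\Gamma^{un}_{2,n})=4n+1$. (d) If $d=3$, $\alpha(\Gamma^{un}_{2,n})=6n$.
   Context: $\alpha(\cdot)$ denotes the independence number of a graph. The zero-divisor graph $\Gamma(M_2(R))$ is the directed graph whose vertices are the nonzero (left or right) zero-divisors of $M_2(R)$, with an edge $v_1\to v_2$ between distinct vertices iff $v_1v_2=0$. For an integer $N\geq1$ and $t\in R$, let $S_{tc,1,t,N}=\{\lambda\begin{bmatrix}1&t\\t^2&t^3\end{bmatrix}:\lambda\in\mathbb{Z},\,1\leq|\lambda|\leq N\}$ and $S_{tc,2,N}=\{\begin{bmatrix}0&0\\0&\lambda\end{bmatrix}:\lambda\in\mathbb{Z},\,1\leq|\lambda|\leq N\}$. Let $\Gamma_{1,N}$ be the induced subgraph of $\Gamma(M_2(R))$ on $S_{tc,1,0,N}\cup S_{tc,2,N}$, regarded as an undirected graph. Let $U=\{\pm1\}$ if $d\neq1,3$, $U=\{\pm1,\pm i\}$ if $d=1$ ($i=\sqrt{-1}$), $U=\{\pm1,\pm\omega,\pm\omega^2\}$ if $d=3$ ($\omega$ a primitive third root of unity); let $\Gamma_{2,N}$ be the induced subgraph of $\Gamma(M_2(R))$ on $\bigcup_{j\in U}S_{tc,1,j,N}$,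 and $\Gamma^{un}_{2,N}$ its underlying undirected graph (distinct $v_1,v_2$ adjacent iff $v_1v_2=0$ or $v_2v_1=0$). *)

theory Defs
  imports
    "HOL-Analysis.Analysis"
    "HOL-Computational_Algebra.Squarefree"
    "HOL-Algebra.Algebraic_Closure_Type"
    "HOL-Algebra.Generated_Fields"
    "Graph_Theory.Digraph_Component"
begin

definition quad_field :: "nat \<Rightarrow> complex set" where
  "quad_field d = generate_field ring_of_type_algebra {csqrt (- of_nat d)}"

definition quad_int :: "nat \<Rightarrow> complex set" where
  "quad_int d = {x \<in> quad_field d. algebraic_int x}"

definition mats2 :: "complex set \<Rightarrow> (complex^2^2) set" where
  "mats2 R = {A. \<forall>i j. A $ i $ j \<in> R}"

definition zero_divisors2 :: "complex set \<Rightarrow> (complex^2^2) set" where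
  "zero_divisors2 R =
     {A \<in> mats2 R. \<exists>B \<in> mats2 R. B \<noteq> 0 \<and> (A ** B = 0 \<or> B ** A = 0)}"

definition zero_divisor_graph :: "complex set \<Rightarrow> (complex^2^2) pair_pre_digraph" where
  "zero_divisor_graph R =
     (let V = zero_divisors2 R - {0}
      in \<lparr> pverts = V, parcs = {(A, B). A \<in> V \<and> B \<in> V \<and> A \<noteq> B \<and> A ** B = 0} \<rparr>)"

definition S_tc1 :: "complex \<Rightarrow> nat \<Rightarrow> (complex^2^2) set" where
  "S_tc1 t N = {of_int l *\<^sub>R vector [vector [1, t], vector [t^2, t^3]] | l :: int.
                  1 \<le> \<bar>l\<bar> \<and> \<bar>l\<bar> \<le> int N}"

definition S_tc2 :: "nat \<Rightarrow> (complex^2^2) set" where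
  "S_tc2 N = {vector [vector [0, 0], vector [0, of_int l]] | l :: int.
                  1 \<le> \<bar>l\<bar> \<and> \<bar>l\<bar> \<le> int N}"

definition omega :: complex where
  "omega = cis (2 * pi / 3)"

definition unit_set :: "nat \<Rightarrow> complex set" where
  "unit_set d =
     (if d = 1 then {1, -1, \<i>, -\<i>}
      else if d = 3 then {1, -1, omega, -omega, omega^2, -(omega^2)}
      else {1, -1})"

text \<open>\<^const>\<open>induce_subgraph\<close> takes the given vertex set without intersecting it with the
  vertices of the ambient graph; \<open>Gamma1_verts\<close> and \<open>Gamma2_verts\<close> below show that here it
  does consist of vertices of the zero-divisor graph.\<close>

definition Gamma1 :: "nat \<Rightarrow> nat \<Rightarrow> (complex^2^2, (complex^2^2) \<times> (complex^2^2)) pre_digraph" where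
  "Gamma1 d N =
     induce_subgraph (with_proj (zero_divisor_graph (quad_int d))) (S_tc1 0 N \<union> S_tc2 N)"

definition Gamma2 :: "nat \<Rightarrow> nat \<Rightarrow> (complex^2^2, (complex^2^2) \<times> (complex^2^2)) pre_digraph" where
  "Gamma2 d N =
     induce_subgraph (with_proj (zero_divisor_graph (quad_int d))) (\<Union>j\<in>unit_set d. S_tc1 j N)"

definition independent_set :: "'a pair_pre_digraph \<Rightarrow> 'a set \<Rightarrow> bool" where
  "independent_set G I \<longleftrightarrow>
     I \<subseteq> pverts G \<and> (\<forall>u\<in>I. \<forall>v\<in>I. (u, v) \<notin> parcs G)"

definition independence_number :: "'a pair_pre_digraph \<Rightarrow> nat" where
  "independence_number G = Max {card I | I. independent_set G I}"

lemma ring_of_type_algebra_simps: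
  "carrier ring_of_type_algebra = UNIV"
  "x \<otimes>\<^bsub>ring_of_type_algebra\<^esub> y = x * y"
  "\<one>\<^bsub>ring_of_type_algebra\<^esub> = 1"
  "\<zero>\<^bsub>ring_of_type_algebra\<^esub> = 0"
  "x \<oplus>\<^bsub>ring_of_type_algebra\<^esub> y = x + y"
  by (simp_all add: ring_of_type_algebra_def)

lemma ring_of_type_algebra_minus:
  "\<ominus>\<^bsub>ring_of_type_algebra\<^esub> x = - (x :: 'a :: field)"
proof -
  interpret F: field "ring_of_type_algebra :: 'a ring" by (rule field_from_type_algebra)
  show ?thesis
    by (rule F.minus_equality) (simp_all add: ring_of_type_algebra_simps)
qed

lemma ring_of_type_algebra_inverse:
  "x \<noteq> 0 \<Longrightarrow> inv\<^bsub>ring_of_type_algebra\<^esub> x = inverse (x :: 'a :: field)"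
proof -
  assume "x \<noteq> 0"
  interpret F: field "ring_of_type_algebra :: 'a ring" by (rule field_from_type_algebra)
  show ?thesis using \<open>x \<noteq> 0\<close>
    by (intro F.comm_inv_char) (simp_all add: ring_of_type_algebra_simps)
qed

lemma quad_field_closed:
  shows quad_field_1: "1 \<in> quad_field d"
    and quad_field_0: "0 \<in> quad_field d"
    and quad_field_sqrt: "csqrt (- of_nat d) \<in> quad_field d"
    and quad_field_minus: "x \<in> quad_field d \<Longrightarrow> - x \<in> quad_field d"
    and quad_field_inverse: "x \<in> quad_field d \<Longrightarrow> inverse x \<in> quad_field d"
    and quad_field_add: "x \<in> quad_field d \<Longrightarrow> y \<in> quad_field d \<Longrightarrow> x + y \<in> quad_field d"
    and quad_field_mult: "x \<in> quad_field d \<Longrightarrow> y \<in> quad_field d \<Longrightarrow> x * y \<in> quad_field d"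
proof -
  let ?R = "ring_of_type_algebra :: complex ring" and ?H = "{csqrt (- of_nat d)}"
  show one: "1 \<in> quad_field d"
    using generate_field.one[of ?R ?H] by (simp add: quad_field_def ring_of_type_algebra_simps)
  show "csqrt (- of_nat d) \<in> quad_field d"
    using generate_field.incl[of _ ?H ?R] by (simp add: quad_field_def)
  show minus: "- x \<in> quad_field d" if "x \<in> quad_field d" for x
    using generate_field.a_inv[of x ?R ?H] that
    by (simp add: quad_field_def ring_of_type_algebra_minus)
  show add: "x + y \<in> quad_field d" if "x \<in> quad_field d" "y \<in> quad_field d" for x y
    using generate_field.eng_add[of x ?R ?H y] that
    by (simp add: quad_field_def ring_of_type_algebra_simps)
  show "x * y \<in> quad_field d" if "x \<in> quad_field d" "y \<in> quad_field d" for x y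
    using generate_field.eng_mult[of x ?R ?H y] that
    by (simp add: quad_field_def ring_of_type_algebra_simps)
  show zero: "0 \<in> quad_field d"
    using add[OF one minus[OF one]] by simp
  show "inverse x \<in> quad_field d" if "x \<in> quad_field d" for x
    using generate_field.m_inv[of x ?R ?H] that zero
    by (cases "x = 0")
       (simp_all add: quad_field_def ring_of_type_algebra_simps ring_of_type_algebra_inverse)
qed

lemma quad_field_of_int: "of_int k \<in> quad_field d"
proof -
  have nat: "of_nat m \<in> quad_field d" for m
    by (induction m) (auto intro: quad_field_0 quad_field_1 quad_field_add)
  show ?thesis
    by (cases k) (auto intro: nat quad_field_minus simp del: of_nat_Suc)
qed

lemma quad_field_power: "x \<in> quad_field d \<Longrightarrow> x ^ m \<in> quad_field d"
  by (induction m) (auto intro: quad_field_1 quad_field_mult)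

lemma quad_field_of_rat: "of_rat q \<in> quad_field d"
  by (cases q)
     (auto simp: of_rat_rat divide_inverse intro!: quad_field_mult quad_field_inverse quad_field_of_int)

lemma csqrt_minus_of_nat_sq: "csqrt (- of_nat d) * csqrt (- of_nat d) = - of_nat d"
  using power2_csqrt[of "- of_nat d"] by (simp add: power2_eq_square)

lemma quad_field_altdef:
  "quad_field d = {of_rat a + of_rat b * csqrt (- of_nat d) | a b. True}" (is "_ = ?K")
proof
  show "?K \<subseteq> quad_field d"
    by (clarify, intro quad_field_add quad_field_mult quad_field_of_rat quad_field_sqrt)
  define s where "s = csqrt (- of_nat d)"
  have ss: "s * s = - of_nat d"
    unfolding s_def by (rule csqrt_minus_of_nat_sq)
  have I: "of_rat a + of_rat b * s \<in> ?K" for a b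
    by (auto simp: s_def)
  have E: "\<exists>a b. x = of_rat a + of_rat b * s" if "x \<in> ?K" for x
    using that by (auto simp: s_def)
  show "quad_field d \<subseteq> ?K"
  proof
    fix x assume "x \<in> quad_field d"
    then have "x \<in> generate_field ring_of_type_algebra {s}"
      by (simp add: quad_field_def s_def)
    then show "x \<in> ?K"
    proof (induction rule: generate_field.induct)
      case one
      show ?case using I[of 1 0] by (simp add: ring_of_type_algebra_simps)
    next
      case (incl h)
      then show ?case using I[of 0 1] by simp
    next
      case (a_inv h)
      then obtain a b where "h = of_rat a + of_rat b * s" using E by blast
      then show ?case using I[of "- a" "- b"]
        by (simp add: ring_of_type_algebra_minus of_rat_minus)
    next
      case (m_inv h)
      then obtain a b where h: "h = of_rat a + of_rat b * s" using E by blast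
      have h0: "h \<noteq> 0" using m_inv by (simp add: ring_of_type_algebra_simps)
      define c where "c = of_rat a - of_rat b * s"
      define m where "m = a * a + of_nat d * (b * b)"
      have hc: "h * c = of_rat m"
      proof -
        have "h * c = of_rat a * of_rat a - of_rat b * of_rat b * (s * s)"
          by (simp add: h c_def algebra_simps)
        then show ?thesis
          by (simp add: ss m_def of_rat_add of_rat_mult algebra_simps)
      qed
      have ihc: "inverse h = of_rat (a / m) + of_rat (- b / m) * s"
      proof (cases "m = 0")
        case False
        then have "inverse h = c * inverse (of_rat m)"
          using hc h0 by (simp add: field_simps)
        then show ?thesis
          by (simp add: c_def of_rat_divide of_rat_minus divide_inverse[symmetric] diff_divide_distrib)
      next
        case True
        have n: "0 \<le> of_nat d * (b * b)" "0 \<le> a * a" by simp_all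
        then have "a * a = 0" "of_nat d * (b * b) = 0"
          using True unfolding m_def by linarith+
        then have "a = 0" "d = 0 \<or> b = 0" by simp_all
        then have "h = 0" using h by (auto simp: s_def)
        then show ?thesis using h0 by simp
      qed
      then show ?case using I[of "a / m" "- b / m"] h0
        by (simp add: ring_of_type_algebra_inverse)
    next
      case (eng_add h1 h2)
      then obtain a b a' b' where "h1 = of_rat a + of_rat b * s" "h2 = of_rat a' + of_rat b' * s"
        using E by meson
      then show ?case using I[of "a + a'" "b + b'"]
        by (simp add: ring_of_type_algebra_simps of_rat_add algebra_simps)
    next
      case (eng_mult h1 h2)
      then obtain a b a' b' where h: "h1 = of_rat a + of_rat b * s" "h2 = of_rat a' + of_rat b' * s"
        using E by meson
      have "h1 * h2 = of_rat a * of_rat a' + of_rat b * of_rat b' * (s * s)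
          + (of_rat a * of_rat b' + of_rat a' * of_rat b) * s"
        by (simp add: h algebra_simps)
      also have "\<dots> = of_rat (a * a' - of_nat d * (b * b')) + of_rat (a * b' + a' * b) * s"
        by (simp add: ss of_rat_add of_rat_diff of_rat_mult algebra_simps)
      finally show ?case using I[of "a * a' - of_nat d * (b * b')" "a * b' + a' * b"]
        by (simp add: ring_of_type_algebra_simps)
    qed
  qed
qed

lemma omega_altdef: "omega = (- 1 + csqrt (- of_nat 3)) * inverse 2"
  by (simp add: omega_def complex_eq_iff cos_120 sin_120)

lemma omega_power3: "omega ^ 3 = 1"
  unfolding omega_def by (subst Complex.DeMoivre) simp

lemma unit_set_quad_field: "t \<in> unit_set d \<Longrightarrow> t \<in> quad_field d"
proof -
  have i: "\<i> \<in> quad_field 1" using quad_field_sqrt[of 1] by simp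
  then have i': "\<i> \<in> quad_field (Suc 0)" by simp
  have w: "omega \<in> quad_field 3" unfolding omega_altdef
    using quad_field_of_int[of 2 3]
    by (intro quad_field_mult quad_field_add quad_field_minus quad_field_inverse
        quad_field_1 quad_field_sqrt) simp
  show "t \<in> unit_set d \<Longrightarrow> t \<in> quad_field d"
    by (auto simp: unit_set_def split: if_splits
        intro: quad_field_1 quad_field_minus i' w quad_field_power)
qed

lemma unit_set_power: "t \<in> unit_set d \<Longrightarrow> t ^ 12 = 1"
proof -
  have "omega ^ 12 = (omega ^ 3) ^ 4" "(omega\<^sup>2) ^ 12 = (omega ^ 3) ^ 8"
    by (simp_all flip: power_mult)
  then have "omega ^ 12 = 1" "(omega\<^sup>2) ^ 12 = 1"
    by (simp_all add: omega_power3)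
  moreover have "\<i> ^ 12 = (\<i> ^ 2) ^ 6" by (simp flip: power_mult)
  ultimately show "t \<in> unit_set d \<Longrightarrow> t ^ 12 = 1"
    by (auto simp: unit_set_def split: if_splits)
qed

lemma quad_int_of_int: "of_int k \<in> quad_int d"
  by (simp add: quad_int_def quad_field_of_int)

lemma quad_int_unit:
  assumes "t = 0 \<or> t \<in> unit_set d"
  shows "of_int k * t ^ m \<in> quad_int d"
proof (cases "t = 0")
  case True
  then show ?thesis using quad_int_of_int[of k d] quad_int_of_int[of 0 d] by (cases m) simp_all
next
  case False
  then have t: "t \<in> unit_set d" using assms by blast
  have "(of_int k * t ^ m) ^ 12 = of_int k ^ 12 * (t ^ 12) ^ m"
    by (simp add: power_mult_distrib mult.commute flip: power_mult)
  then have eq: "(of_int k * t ^ m) ^ 12 = of_int (k ^ 12)"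
    by (simp add: unit_set_power[OF t])
  have "algebraic_int (of_int k * t ^ m)"
  proof (rule algebraic_int_root)
    show "algebraic_int (of_int (k ^ 12) :: complex)" by (rule algebraic_int_of_int)
    show "poly (Polynomial.monom 1 12) (of_int k * t ^ m) = of_int (k ^ 12)"
      unfolding poly_monom eq by (rule mult_1)
  qed (simp_all add: Polynomial.degree_monom_eq)
  then show ?thesis
    unfolding quad_int_def using unit_set_quad_field[OF t]
    by (blast intro: quad_field_mult quad_field_of_int quad_field_power)
qed

lemma S_tc1_verts:
  assumes "t = 0 \<or> t \<in> unit_set d"
  shows "S_tc1 t N \<subseteq> pverts (zero_divisor_graph (quad_int d))"
proof
  fix A assume "A \<in> S_tc1 t N"
  then obtain l :: int where l1: "1 \<le> \<bar>l\<bar>"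
    and A0: "A = of_int l *\<^sub>R vector [vector [1, t], vector [t^2, t^3]]"
    unfolding S_tc1_def by blast
  from l1 have l: "l \<noteq> 0" by auto
  have A: "A $ 1 $ 1 = of_int l" "A $ 1 $ 2 = of_int l * t"
      "A $ 2 $ 1 = of_int l * t^2" "A $ 2 $ 2 = of_int l * t^3"
    unfolding A0 vector_scaleR_component by (simp_all add: scaleR_conv_of_real[where 'a = complex])
  define B :: "complex^2^2" where "B = vector [vector [- t, 0], vector [1, 0]]"
  have r: "of_int k * t ^ m \<in> quad_int d" for k m
    by (rule quad_int_unit[OF assms])
  have "A \<in> mats2 (quad_int d)"
    using r[of l 0] r[of l 1] r[of l 2] r[of l 3]
    by (simp add: mats2_def A forall_2)
  moreover have "B \<in> mats2 (quad_int d)"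
    using r[of "-1" 1] r[of 0 0] r[of 1 0] by (simp add: mats2_def B_def forall_2)
  moreover have "A ** B = 0"
    by (simp add: A B_def vec_eq_iff forall_2 matrix_matrix_mult_def sum_2
        power2_eq_square power3_eq_cube)
  moreover have "A \<noteq> 0" "B \<noteq> 0"
    using l by (auto simp: A B_def vec_eq_iff forall_2)
  ultimately show "A \<in> pverts (zero_divisor_graph (quad_int d))"
    unfolding zero_divisor_graph_def zero_divisors2_def Let_def by auto
qed

lemma S_tc2_verts: "S_tc2 N \<subseteq> pverts (zero_divisor_graph (quad_int d))"
proof
  fix A assume "A \<in> S_tc2 N"
  then obtain l :: int where l1: "1 \<le> \<bar>l\<bar>" and A: "A = vector [vector [0, 0], vector [0, of_int l]]"
    unfolding S_tc2_def by blast
  from l1 have l: "l \<noteq> 0" by auto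
  define B :: "complex^2^2" where "B = vector [vector [1, 0], vector [0, 0]]"
  have "A \<in> mats2 (quad_int d)" "B \<in> mats2 (quad_int d)"
    using quad_int_of_int[of l d] quad_int_of_int[of 0 d] quad_int_of_int[of 1 d]
    by (simp_all add: mats2_def A B_def forall_2)
  moreover have "A ** B = 0"
    by (simp add: A B_def vec_eq_iff forall_2 matrix_matrix_mult_def sum_2)
  moreover have "A \<noteq> 0" "B \<noteq> 0"
    using l by (auto simp: A B_def vec_eq_iff forall_2)
  ultimately show "A \<in> pverts (zero_divisor_graph (quad_int d))"
    unfolding zero_divisor_graph_def zero_divisors2_def Let_def by auto
qed

lemma Gamma1_verts:
  "verts (Gamma1 d N) \<subseteq> pverts (zero_divisor_graph (quad_int d))"
  using S_tc1_verts[of 0] S_tc2_verts by (simp add: Gamma1_def)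

lemma Gamma2_verts:
  "verts (Gamma2 d N) \<subseteq> pverts (zero_divisor_graph (quad_int d))"
  using S_tc1_verts by (fastforce simp: Gamma2_def)

end

theory Submission
  imports Defs
begin

text \<open>
  Every matrix \<open>[1, t; t\<^sup>2, t\<^sup>3]\<close> is the rank-one product of the column \<open>(1, t\<^sup>2)\<close> and the row
  \<open>(1, t)\<close>, so nonzero multiples with parameters \<open>s\<close> and \<open>t\<close> (in this order) multiply to zero iff
  \<open>s t\<^sup>2 = -1\<close>. If \<open>s\<^sup>3 = 1\<close>, the class of \<open>-s\<close> is therefore a clique joined completely to the
  class of \<open>s\<close>, and an independent set meets the union of both classes in at most \<open>2n\<close> points.
  For \<open>d = 3\<close> and for \<open>d \<noteq> 1, 3\<close> the vertices split into such pairs of classes, and the classes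
  with \<open>s\<^sup>3 = 1\<close> together form an independent set. For \<open>d = 1\<close> the classes of \<open>\<i>\<close> and \<open>-\<i>\<close> form an
  independent set, to which exactly one member of the class of \<open>-1\<close> can be added.
\<close>

section \<open>Products and cardinalities of the classes of matrices\<close>

definition tc_mat :: "complex \<Rightarrow> int \<Rightarrow> complex^2^2" where
  "tc_mat t l = of_int l *\<^sub>R vector [vector [1, t], vector [t^2, t^3]]"

lemma tc_mat_nth [simp]:
  "tc_mat t l $ 1 $ 1 = of_int l" "tc_mat t l $ 1 $ 2 = of_int l * t"
  "tc_mat t l $ 2 $ 1 = of_int l * t^2" "tc_mat t l $ 2 $ 2 = of_int l * t^3"
  unfolding tc_mat_def vector_scaleR_component
  by (simp_all add: scaleR_conv_of_real[where 'a = complex])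

lemma tc_mat_eq_iff: "tc_mat s l = tc_mat t m \<longleftrightarrow> l = m \<and> (l = 0 \<or> s = t)"
  by (auto simp: vec_eq_iff forall_2)

text \<open>The product is \<open>l * m * (1 + s * t^2)\<close> times the matrix with rows
  \<open>(1, t)\<close> and \<open>(s^2, s^2 * t)\<close>. That matrix has an entry 1, so only the
  scalar can vanish.\<close>

lemma tc_mat_mult_eq_0_iff:
  "tc_mat s l ** tc_mat t m = 0 \<longleftrightarrow> l = 0 \<or> m = 0 \<or> s * t^2 = -1"
proof -
  have eq: "tc_mat s l ** tc_mat t m = 0 \<longleftrightarrow>
      (of_int l * of_int m) * (1 + s * t^2) = 0 \<and> (of_int l * of_int m) * (1 + s * t^2) * t = 0 \<and>
      (of_int l * of_int m) * (1 + s * t^2) * s^2 = 0 \<and>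
      (of_int l * of_int m) * (1 + s * t^2) * (s^2 * t) = 0"
    unfolding vec_eq_iff forall_2
    by (simp add: matrix_matrix_mult_def sum_2 algebra_simps power2_eq_square power3_eq_cube)
  have "1 + s * t^2 = 0 \<longleftrightarrow> s * t^2 = -1"
    by (simp add: add_eq_0_iff)
  then show ?thesis
    unfolding eq by auto
qed

lemma nonzero_symmetric_interval: "{- int n..int n} - {0} = {l. 1 \<le> \<bar>l\<bar> \<and> \<bar>l\<bar> \<le> int n}"
  by auto

lemma S_tc1_eq_image: "S_tc1 t n = tc_mat t ` ({- int n..int n} - {0})"
  unfolding nonzero_symmetric_interval S_tc1_def tc_mat_def by blast

lemma S_tc2_eq_image:
  "S_tc2 n = (\<lambda>l. vector [vector [0, 0], vector [0, of_int l]]) ` ({- int n..int n} - {0})"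
  unfolding nonzero_symmetric_interval S_tc2_def by blast

lemma finite_S_tc1 [simp]: "finite (S_tc1 t n)"
  by (simp add: S_tc1_eq_image)

lemma finite_S_tc2 [simp]: "finite (S_tc2 n)"
  by (simp add: S_tc2_eq_image)

lemma card_S_tc1: "card (S_tc1 t n) = 2 * n"
  unfolding S_tc1_eq_image
  by (subst card_image) (auto intro!: inj_onI simp: tc_mat_eq_iff)

lemma card_S_tc2: "card (S_tc2 n) = 2 * n"
  unfolding S_tc2_eq_image
  by (subst card_image) (auto intro!: inj_onI simp: vec_eq_iff forall_2)

lemma S_tc1_disjoint: "s \<noteq> t \<Longrightarrow> S_tc1 s n \<inter> S_tc1 t n = {}"
  by (auto simp: S_tc1_eq_image tc_mat_eq_iff)

lemma S_tc1_mult_eq_0_iff: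
  "A \<in> S_tc1 s n \<Longrightarrow> B \<in> S_tc1 t n \<Longrightarrow> A ** B = 0 \<longleftrightarrow> s * t^2 = -1"
  by (auto simp: S_tc1_eq_image tc_mat_mult_eq_0_iff)

lemma S_tc2_mult_S_tc1_0: "A \<in> S_tc2 n \<Longrightarrow> B \<in> S_tc1 0 n \<Longrightarrow> A ** B = 0"
  by (auto simp: S_tc1_eq_image S_tc2_eq_image vec_eq_iff forall_2 matrix_matrix_mult_def sum_2)

section \<open>Independent sets in terms of matrix products\<close>

text \<open>Ordered pairs cover both \<open>A ** B\<close> and \<open>B ** A\<close>. Equal factors
  are exempt because squares may vanish, as they do in the class of -1.\<close>

definition annihilator_free :: "(complex^2^2) set \<Rightarrow> bool" where
  "annihilator_free I \<longleftrightarrow> (\<forall>A\<in>I. \<forall>B\<in>I. A \<noteq> B \<longrightarrow> A ** B \<noteq> 0)"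

lemma annihilator_freeD:
  "annihilator_free I \<Longrightarrow> A \<in> I \<Longrightarrow> B \<in> I \<Longrightarrow> A ** B = 0 \<Longrightarrow> A = B"
  by (auto simp: annihilator_free_def)

text \<open>Since \<open>W\<close> consists of vertices of the zero-divisor graph, adjacency inside
  it is decided by products alone; \<open>mk_symmetric\<close> admits both orders of the
  factors.\<close>

lemma independent_set_induced_zero_divisor_graph:
  assumes "W \<subseteq> pverts (zero_divisor_graph R)"
  shows "independent_set (mk_symmetric (induce_subgraph (with_proj (zero_divisor_graph R)) W)) I
    \<longleftrightarrow> I \<subseteq> W \<and> annihilator_free I"
proof -
  have W: "W \<subseteq> zero_divisors2 R - {0}"
    using assms by (simp add: zero_divisor_graph_def Let_def)
  have "(A, B) \<in> parcs (mk_symmetric (induce_subgraph (with_proj (zero_divisor_graph R)) W))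
      \<longleftrightarrow> A \<in> W \<and> B \<in> W \<and> A \<noteq> B \<and> (A ** B = 0 \<or> B ** A = 0)" for A B
    using W by (simp add: parcs_mk_symmetric zero_divisor_graph_def Let_def) blast
  then show ?thesis
    unfolding independent_set_def annihilator_free_def by (simp add: subset_iff) blast
qed

lemma independence_number_eqI:
  assumes "finite (pverts G)" "independent_set G I" "card I = k"
    and "\<And>J. independent_set G J \<Longrightarrow> card J \<le> k"
  shows "independence_number G = k"
proof -
  have "{card I | I. independent_set G I} \<subseteq> card ` Pow (pverts G)"
    by (auto simp: independent_set_def)
  then have "finite {card I | I. independent_set G I}"
    using assms(1) finite_subset by blast
  then show ?thesis
    unfolding independence_number_def using assms by (intro Max_eqI) auto
qed

lemma independence_number_induced_zero_divisor_graph: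
  assumes "W \<subseteq> pverts (zero_divisor_graph R)" "finite W"
    and "I \<subseteq> W" "annihilator_free I" "card I = k"
    and "\<And>J. J \<subseteq> W \<Longrightarrow> annihilator_free J \<Longrightarrow> card J \<le> k"
  shows "independence_number (mk_symmetric (induce_subgraph (with_proj (zero_divisor_graph R)) W)) = k"
  using assms
  by (intro independence_number_eqI[of _ I])
     (auto simp: independent_set_induced_zero_divisor_graph)

section \<open>The graph \<open>Gamma1\<close>\<close>

text \<open>The two classes consist of multiples of the two diagonal matrix units, which annihilate
  each other, so an independent set lies in one class.\<close>

lemma independence_number_Gamma1:
  "independence_number (mk_symmetric (Gamma1 d n)) = 2 * n"
  unfolding Gamma1_def
proof (rule independence_number_induced_zero_divisor_graph)
  show "S_tc1 0 n \<union> S_tc2 n \<subseteq> pverts (zero_divisor_graph (quad_int d))"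
    using S_tc1_verts[of 0] S_tc2_verts by simp
  show "annihilator_free (S_tc1 0 n)"
    by (auto simp: annihilator_free_def S_tc1_mult_eq_0_iff)
  show "card J \<le> 2 * n" if J: "J \<subseteq> S_tc1 0 n \<union> S_tc2 n" "annihilator_free J" for J
  proof -
    have "J \<subseteq> S_tc1 0 n \<or> J \<subseteq> S_tc2 n"
    proof (rule ccontr)
      assume "\<not> ?thesis"
      \<comment> \<open>By exclusion \<open>A\<close> is in \<open>S_tc2 n\<close> and
        \<open>B\<close> in \<open>S_tc1 0 n\<close>, so \<open>A ** B = 0\<close> forces
        \<open>A = B\<close>, which is absurd.\<close>
      then obtain A B where "A \<in> J" "A \<notin> S_tc1 0 n" "B \<in> J" "B \<notin> S_tc2 n"
        by blast
      then show False
        using J S_tc2_mult_S_tc1_0[of A n B] annihilator_freeD[of J A B] by blast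
    qed
    then show ?thesis
      using card_mono[of "S_tc1 0 n" J] card_mono[of "S_tc2 n" J] by (auto simp: card_S_tc1 card_S_tc2)
  qed
qed (simp_all add: card_S_tc1)

section \<open>The graph \<open>Gamma2\<close>\<close>

text \<open>For \<open>t = s\<close> and \<open>t = - s\<close> one has
  \<open>(- s) * t^2 = - (s^3) = -1\<close>, so a member of the class of \<open>- s\<close> excludes
  all else in the pair. Without one, only the class of \<open>s\<close> is left.\<close>

lemma card_annihilator_free_Int_pair:
  assumes "annihilator_free J" "s ^ 3 = 1" "n \<ge> 1"
  shows "card (J \<inter> (S_tc1 s n \<union> S_tc1 (- s) n)) \<le> 2 * n"
proof (cases "J \<inter> S_tc1 (- s) n = {}")
  case True
  then have "J \<inter> (S_tc1 s n \<union> S_tc1 (- s) n) \<subseteq> S_tc1 s n" by blast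
  then show ?thesis
    using card_mono[OF finite_S_tc1] by (metis card_S_tc1)
next
  case False
  then obtain A where A: "A \<in> J" "A \<in> S_tc1 (- s) n" by blast
  have "s * s^2 = 1"
    using assms(2) by (simp add: power3_eq_cube power2_eq_square mult.assoc)
  then have "A ** B = 0" if "B \<in> S_tc1 s n \<union> S_tc1 (- s) n" for B
    using that A(2) by (auto simp: S_tc1_mult_eq_0_iff)
  then have "J \<inter> (S_tc1 s n \<union> S_tc1 (- s) n) \<subseteq> {A}"
    using annihilator_freeD[OF assms(1) A(1)] by blast
  then have "card (J \<inter> (S_tc1 s n \<union> S_tc1 (- s) n)) \<le> card {A}"
    by (intro card_mono) auto
  \<comment> \<open>The bound \<open>1 \<le> 2 * n\<close> is where \<open>n \<ge> 1\<close>
    enters.\<close>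
  then show ?thesis using assms(3) by simp
qed

lemma independence_number_Gamma2_generic:
  assumes "d \<noteq> 1" "d \<noteq> 3" "n \<ge> 1"
  shows "independence_number (mk_symmetric (Gamma2 d n)) = 2 * n"
  unfolding Gamma2_def
proof (rule independence_number_induced_zero_divisor_graph)
  have U: "unit_set d = {1, -1}"
    using assms by (simp add: unit_set_def)
  show "(\<Union>j\<in>unit_set d. S_tc1 j n) \<subseteq> pverts (zero_divisor_graph (quad_int d))"
    using S_tc1_verts by fast
  show "S_tc1 1 n \<subseteq> (\<Union>j\<in>unit_set d. S_tc1 j n)" "finite (\<Union>j\<in>unit_set d. S_tc1 j n)"
    by (auto simp: U)
  show "annihilator_free (S_tc1 1 n)"
    by (auto simp: annihilator_free_def S_tc1_mult_eq_0_iff)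
  show "card J \<le> 2 * n" if J: "J \<subseteq> (\<Union>j\<in>unit_set d. S_tc1 j n)" "annihilator_free J" for J
  proof -
    have "J = J \<inter> (S_tc1 1 n \<union> S_tc1 (- 1) n)"
      using J(1) by (auto simp: U)
    then show ?thesis
      using card_annihilator_free_Int_pair[OF J(2), of 1 n] assms(3) by simp
  qed
qed (simp add: card_S_tc1)

text \<open>The class of 1 is joined to all others: \<open>(-1) * 1^2 = -1\<close>, and
  \<open>1 * t^2 = -1\<close> for \<open>t = \<i>\<close> and \<open>t = - \<i>\<close>. The only
  other zero products lie within the class of -1.\<close>

lemma independence_number_Gamma2_Gauss:
  assumes "n \<ge> 1"
  shows "independence_number (mk_symmetric (Gamma2 1 n)) = 4 * n + 1"
  unfolding Gamma2_def
proof (rule independence_number_induced_zero_divisor_graph)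
  have U: "unit_set (Suc 0) = {1, -1, \<i>, -\<i>}"
    by (simp add: unit_set_def)
  have neq: "\<i> \<noteq> - \<i>" "\<i> \<noteq> -1" "-\<i> \<noteq> -1" "-\<i> \<noteq> 1" "\<i> \<noteq> 1"
    by (auto simp: complex_eq_iff)
  define S where "S = S_tc1 \<i> n \<union> S_tc1 (- \<i>) n"
  have card_S: "card S = 4 * n"
    unfolding S_def by (subst card_Un_disjoint) (auto simp: S_tc1_disjoint neq card_S_tc1)
  have "tc_mat (-1) 1 \<in> S_tc1 (-1) n"
    using assms by (auto simp: S_tc1_eq_image)
  then have A: "tc_mat (-1) 1 \<in> S_tc1 (-1) n" "tc_mat (-1) 1 \<notin> S"
    using S_tc1_disjoint[of "-1" \<i> n] S_tc1_disjoint[of "-1" "-\<i>" n] neq by (auto simp: S_def)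
  show "(\<Union>j\<in>unit_set 1. S_tc1 j n) \<subseteq> pverts (zero_divisor_graph (quad_int 1))"
    using S_tc1_verts by fast
  show "finite (\<Union>j\<in>unit_set 1. S_tc1 j n)"
    by (auto simp: U)
  show "insert (tc_mat (-1) 1) S \<subseteq> (\<Union>j\<in>unit_set 1. S_tc1 j n)"
    using A by (auto simp: U S_def)
  have "A ** B \<noteq> 0" if "A \<in> S" "B \<in> S" for A B
    using that neq by (auto simp: S_def S_tc1_mult_eq_0_iff)
  moreover have "tc_mat (-1) 1 ** B \<noteq> 0" "B ** tc_mat (-1) 1 \<noteq> 0" if "B \<in> S" for B
    using that A(1) neq by (auto simp: S_def S_tc1_mult_eq_0_iff)
  ultimately show "annihilator_free (insert (tc_mat (-1) 1) S)"
    unfolding annihilator_free_def by blast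
  show "card (insert (tc_mat (-1) 1) S) = 4 * n + 1"
    using A card_S by (subst card_insert_disjoint) (auto simp: S_def)
  show "card J \<le> 4 * n + 1" if J: "J \<subseteq> (\<Union>j\<in>unit_set 1. S_tc1 j n)" "annihilator_free J" for J
  \<comment> \<open>If \<open>J\<close> avoids the class of 1, it has at most one member in the
    class of -1 and at most \<open>4 * n\<close> in \<open>S\<close>; otherwise it stays inside the
    class of 1.\<close>
  proof (cases "J \<inter> S_tc1 1 n = {}")
    case True
    have "card (J \<inter> S_tc1 (-1) n) \<le> 1"
    proof -
      have "A = B" if "A \<in> J \<inter> S_tc1 (-1) n" "B \<in> J \<inter> S_tc1 (-1) n" for A B
        using that annihilator_freeD[OF J(2), of A B] by (auto simp: S_tc1_mult_eq_0_iff)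
      then show ?thesis
        by (simp add: card_le_Suc0_iff_eq)
    qed
    moreover have "card (J \<inter> S) \<le> 4 * n"
      using card_mono[of S "J \<inter> S"] card_S by (simp add: S_def)
    moreover have "J = (J \<inter> S_tc1 (-1) n) \<union> (J \<inter> S)"
      using J(1) True by (auto simp: U S_def)
    then have "card J \<le> card (J \<inter> S_tc1 (-1) n) + card (J \<inter> S)"
      by (metis card_Un_le)
    ultimately show ?thesis by linarith
  next
    case False
    then obtain A where A: "A \<in> J" "A \<in> S_tc1 1 n" by blast
    have "B \<in> S_tc1 1 n" if "B \<in> J" for B
    proof -
      \<comment> \<open>\<open>B ** A = 0\<close> for \<open>B\<close> in the class of -1, and
        \<open>A ** B = 0\<close> for the classes of \<open>\<i>\<close> and
        \<open>- \<i>\<close>.\<close>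
      have "A = B" if "B \<notin> S_tc1 1 n"
        using that \<open>B \<in> J\<close> J(1) A annihilator_freeD[OF J(2), of A B] annihilator_freeD[OF J(2), of B A]
        by (auto simp: U S_tc1_mult_eq_0_iff)
      then show ?thesis using A by blast
    qed
    then have "card J \<le> 2 * n"
      using card_mono[of "S_tc1 1 n" J] by (auto simp: card_S_tc1)
    then show ?thesis by simp
  qed
qed

lemma omega_neq: "omega \<noteq> 1" "omega\<^sup>2 \<noteq> 1" "omega \<noteq> omega\<^sup>2"
proof -
  show 1: "omega \<noteq> 1"
    by (simp add: omega_def complex_eq_iff cos_120)
  show "omega\<^sup>2 \<noteq> 1" "omega \<noteq> omega\<^sup>2"
    using 1 omega_power3 by (auto simp: power3_eq_cube power2_eq_square)
qed

lemma independence_number_Gamma2_Eisenstein: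
  assumes "n \<ge> 1"
  shows "independence_number (mk_symmetric (Gamma2 3 n)) = 6 * n"
  unfolding Gamma2_def
proof (rule independence_number_induced_zero_divisor_graph)
  \<comment> \<open>The cube roots of unity represent the six units up to sign.\<close>
  define C where "C = {1, omega, omega\<^sup>2}"
  have U: "unit_set 3 = C \<union> uminus ` C"
    by (auto simp: unit_set_def C_def)
  have "(omega\<^sup>2) ^ 3 = (omega ^ 3)\<^sup>2"
    by (simp flip: power_mult)
  then have cube: "s ^ 3 = 1" if "s \<in> C" for s
    using that omega_power3 by (auto simp: C_def)
  have card_C: "finite C" "card C = 3"
    using omega_neq by (auto simp: C_def)
  show "(\<Union>j\<in>unit_set 3. S_tc1 j n) \<subseteq> pverts (zero_divisor_graph (quad_int 3))"
    using S_tc1_verts by fast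
  show "finite (\<Union>j\<in>unit_set 3. S_tc1 j n)"
    using card_C by (auto simp: U)
  show "(\<Union>s\<in>C. S_tc1 s n) \<subseteq> (\<Union>j\<in>unit_set 3. S_tc1 j n)"
    by (auto simp: U)
  have "s * t\<^sup>2 \<noteq> -1" if "s \<in> C" "t \<in> C" for s t
  proof
    assume "s * t\<^sup>2 = -1"
    \<comment> \<open>Cubing separates the two sides: the left gives 1, the right -1.\<close>
    moreover have "(s * t\<^sup>2) ^ 3 = s ^ 3 * (t ^ 3)\<^sup>2"
      by (simp add: power_mult_distrib flip: power_mult)
    ultimately show False
      using cube that by simp
  qed
  then show "annihilator_free (\<Union>s\<in>C. S_tc1 s n)"
    by (auto simp: annihilator_free_def S_tc1_mult_eq_0_iff)
  show "card (\<Union>s\<in>C. S_tc1 s n) = 6 * n"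
    using card_C by (subst card_UN_disjoint) (auto simp: S_tc1_disjoint card_S_tc1)
  show "card J \<le> 6 * n" if J: "J \<subseteq> (\<Union>j\<in>unit_set 3. S_tc1 j n)" "annihilator_free J" for J
  proof -
    \<comment> \<open>The three pairs of classes cover all vertices, and each contributes at most
      \<open>2 * n\<close>.\<close>
    have "J = (\<Union>s\<in>C. J \<inter> (S_tc1 s n \<union> S_tc1 (- s) n))"
      using J(1) by (auto simp: U)
    then have "card J \<le> (\<Sum>s\<in>C. card (J \<inter> (S_tc1 s n \<union> S_tc1 (- s) n)))"
      using card_UN_le[OF card_C(1), of "\<lambda>s. J \<inter> (S_tc1 s n \<union> S_tc1 (- s) n)"] by argo
    also have "\<dots> \<le> (\<Sum>s\<in>C. 2 * n)"
      by (intro sum_mono card_annihilator_free_Int_pair J(2) cube assms)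
    finally show ?thesis
      using card_C by simp
  qed
qed

theorem theorem3p21:
  fixes d n :: nat
  assumes "d = 0 \<or> squarefree d"
    and "n \<ge> 1"
  shows "independence_number (mk_symmetric (Gamma1 d n)) = 2 * n \<and>
    (d \<noteq> 1 \<and> d \<noteq> 3 \<longrightarrow> independence_number (mk_symmetric (Gamma2 d n)) = 2 * n) \<and>
    (d = 1 \<longrightarrow> independence_number (mk_symmetric (Gamma2 d n)) = 4 * n + 1) \<and>
    (d = 3 \<longrightarrow> independence_number (mk_symmetric (Gamma2 d n)) = 6 * n)"
  using assms(2) independence_number_Gamma1 independence_number_Gamma2_generic
    independence_number_Gamma2_Gauss independence_number_Gamma2_Eisenstein by blast

end
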